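(* Let $F:I\to\mathbb{R}$ be affine on $I$ and let $g_1,g_2:I\to\mathbb{R}$ be continuous functions strictly monotone in the same sense. Let $f_1,f_2:I\to\mathbb{R}$ and $G:g_1(I)+g_2(I)\to\mathbb{R}$. Then $$F\Big(\frac{x+y}{2}\Big)+f_1(x)+f_2(y)=G(g_1(x)+g_2(y)),\qquad x,y\in I,$$ holds if and only if there exist an additive function $B:\mathbb{R}\to\mathbb{R}$ and $\lambda_1,\lambda_2,\Lambda\in\mathbb{R}$ with $\Lambda=\lambda_1+\lambda_2$ such that $$f_k=-\tfrac12F+B\circ g_k+\lambda_k\quad\text{on } I\ (k=1,2)\qquad\text{and}\qquad G=B+\Lambda\quad\text{on } g_1(I)+g_2(I).$$
   Context: $I\subseteq\mathbb{R}$ is a nonempty open interval. $X+Y=\{x+y\mid x\in X,\ y\in Y\}$. $F$ is affine on $I$ if $F\big(\frac{u+v}{2}\big)=\frac{F(u)+F(v)}{2}$ for all $u,v\in I$ (no continuity is assumed). A function $B:\mathbb{R}\to\mathbb{R}$ is additive if $B(s+t)=B(s)+B(t)$ for all $s,t\in\mathbb{R}$. "Strictly monotone in the same sense" means both strictly increasing or both strictly decreasing. *)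

theory Defs
  imports "HOL-Analysis.Analysis" "HOL-Library.Set_Algebras"
begin

(* Functions on a subset of the reals are total functions constrained only on that subset.
   Only the midpoint equation is required (Jensen affinity), without any regularity. *)
definition midpoint_affine_on :: "real set \<Rightarrow> (real \<Rightarrow> real) \<Rightarrow> bool" where
  "midpoint_affine_on I F \<longleftrightarrow> (\<forall>u\<in>I. \<forall>v\<in>I. F ((u + v) / 2) = (F u + F v) / 2)"

definition strictly_monotone_same_sense_on ::
    "real set \<Rightarrow> (real \<Rightarrow> real) \<Rightarrow> (real \<Rightarrow> real) \<Rightarrow> bool" where
  "strictly_monotone_same_sense_on I g h \<longleftrightarrow>
     (strict_mono_on I g \<and> strict_mono_on I h) \<or>
     (strict_antimono_on I g \<and> strict_antimono_on I h)"

end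

theory Submission
  imports Defs
begin

text \<open>
  Since \<open>F\<close> satisfies \<open>F ((x + y) / 2) = (F x + F y) / 2\<close>, the functions \<open>h\<^sub>k = f\<^sub>k + F / 2\<close>
  turn the equation into \<open>h\<^sub>1 x + h\<^sub>2 y = G (g\<^sub>1 x + g\<^sub>2 y)\<close>. Being continuous and injective, \<open>g\<^sub>k\<close>
  maps \<open>I\<close> bijectively onto an open interval, so \<open>p = h\<^sub>1 \<circ> g\<^sub>1\<inverse>\<close> and \<open>q = h\<^sub>2 \<circ> g\<^sub>2\<inverse>\<close> solve the
  Pexider equation \<open>p u + q v = G (u + v)\<close> on a product of two open intervals.

  This restricted Pexider equation is solved without any regularity
  (\<open>pexider_on_open_intervals\<close>). Moving a small \<open>t\<close> from one argument to the other shows that the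
  increments \<open>p (u + t) - p u\<close> and \<open>q (v + t) - q v\<close> agree and depend on \<open>t\<close> only, say they equal
  \<open>a t\<close>. Hence \<open>a\<close> is additive near \<open>0\<close>, and it extends to an additive \<open>B\<close> on the real line by
  scaling (\<open>locally_additive_extends\<close>). Then \<open>p - B\<close> and \<open>q - B\<close> are locally constant, hence
  constant on their intervals.
\<close>

lemma locally_additive_extends:
  fixes a :: "real \<Rightarrow> real"
  assumes e: "e > 0"
    and add: "\<And>s t. \<bar>s\<bar> < e \<Longrightarrow> \<bar>t\<bar> < e \<Longrightarrow> \<bar>s + t\<bar> < e \<Longrightarrow> a (s + t) = a s + a t"
  obtains B where "Modules.additive B" and "\<And>t. \<bar>t\<bar> < e \<Longrightarrow> B t = a t"
proof -
  \<comment> \<open>The sequence \<open>2 ^ n * a (x / 2 ^ n)\<close> is constant once its argument lies within \<open>e\<close> of \<open>0\<close>.\<close>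
  define S where "S x n = 2 ^ n * a (x / 2 ^ n)" for x :: real and n :: nat
  define B where "B x = lim (S x)" for x
  have S_const: "S x n = S x N" if "\<bar>x / 2 ^ N\<bar> < e" "n \<ge> N" for x n N
    using that(2)
  proof (induction n rule: dec_induct)
    case base
    show ?case ..
  next
    case (step n)
    define s where "s = x / 2 ^ Suc n"
    have "(2::real) ^ N \<le> 2 ^ n"
      using step.hyps by (intro power_increasing) auto
    then have "\<bar>x / 2 ^ n\<bar> \<le> \<bar>x / 2 ^ N\<bar>"
      by (auto simp: abs_divide intro!: divide_left_mono)
    moreover have ss: "s + s = x / 2 ^ n"
      by (simp add: s_def field_simps)
    ultimately have "\<bar>s + s\<bar> < e"
      using that(1) by linarith
    then have "a (s + s) = a s + a s"
      by (intro add) auto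
    then have "S x (Suc n) = S x n"
      unfolding S_def ss s_def[symmetric] by simp
    with step.IH show ?case by simp
  qed
  have small: "\<forall>\<^sub>F n in sequentially. \<bar>x / 2 ^ n\<bar> < e" for x
  proof -
    have "(\<lambda>n. \<bar>x\<bar> * (1 / 2) ^ n) \<longlonglongrightarrow> \<bar>x\<bar> * 0"
      by (intro tendsto_intros LIMSEQ_power_zero) simp
    then have "(\<lambda>n. \<bar>x / 2 ^ n\<bar>) \<longlonglongrightarrow> 0"
      by (simp add: power_one_over)
    then show ?thesis
      using e by (rule order_tendstoD)
  qed
  have S_lim: "S x \<longlonglongrightarrow> S x N" if "\<bar>x / 2 ^ N\<bar> < e" for x N
    by (rule tendsto_eventually) (use S_const[OF that] in \<open>blast intro: eventually_sequentiallyI\<close>)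
  have S_B: "S x \<longlonglongrightarrow> B x" for x
  proof -
    obtain N where "\<bar>x / 2 ^ N\<bar> < e"
      using small[of x] eventually_happens'[OF sequentially_bot] by blast
    then have "S x \<longlonglongrightarrow> S x N" by (rule S_lim)
    then show ?thesis unfolding B_def by (simp add: limI)
  qed
  have "B (x + y) = B x + B y" for x y
  proof (rule LIMSEQ_unique)
    show "S (x + y) \<longlonglongrightarrow> B (x + y)" by (rule S_B)
    have "\<forall>\<^sub>F n in sequentially. S x n + S y n = S (x + y) n"
      using small[of x] small[of y] small[of "x + y"]
    proof eventually_elim
      case (elim n)
      then have "a (x / 2 ^ n + y / 2 ^ n) = a (x / 2 ^ n) + a (y / 2 ^ n)"
        by (intro add) (auto simp: add_divide_distrib)
      then show ?case
        by (simp add: S_def add_divide_distrib distrib_left)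
    qed
    then show "S (x + y) \<longlonglongrightarrow> B x + B y"
      using tendsto_add[OF S_B S_B] by (rule Lim_transform_eventually[rotated])
  qed
  moreover have "B t = a t" if "\<bar>t\<bar> < e" for t
    using LIMSEQ_unique[OF S_B S_lim[of t 0]] that by (simp add: S_def)
  ultimately show thesis
    by (intro that[of B]) (auto intro: additive.intro)
qed

lemma additive_plus_constant_on_connected:
  fixes p B :: "real \<Rightarrow> real"
  assumes "connected U" and B: "Modules.additive B" and e: "e > 0"
    and incr: "\<And>u t. u \<in> U \<Longrightarrow> u + t \<in> U \<Longrightarrow> \<bar>t\<bar> < e \<Longrightarrow> p (u + t) - p u = B t"
  obtains c where "\<And>u. u \<in> U \<Longrightarrow> p u = B u + c"
proof -
  have "p u - B u = p v - B v" if "u \<in> U" "v \<in> U" for u v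
  proof (rule connected_local_const[OF \<open>connected U\<close> that], rule ballI)
    fix x assume x: "x \<in> U"
    have "p x - B x = p y - B y" if "y \<in> U" "dist y x < e" for y
      using incr[of x "y - x"] x that additive.diff[OF B, of y x] by (simp add: dist_real_def)
    then show "\<forall>\<^sub>F y in at x within U. p x - B x = p y - B y"
      using e unfolding eventually_at by blast
  qed
  then show thesis
    using that by (metis add.commute diff_add_cancel)
qed

text \<open>The additive function is common to both summands; only the constants differ.\<close>

lemma pexider_on_open_intervals:
  fixes p q G :: "real \<Rightarrow> real"
  assumes U: "open U" "connected U" "U \<noteq> {}" and V: "open V" "connected V" "V \<noteq> {}"
    and eq: "\<And>u v. u \<in> U \<Longrightarrow> v \<in> V \<Longrightarrow> p u + q v = G (u + v)"
  obtains B c d where "Modules.additive B"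
    and "\<And>u. u \<in> U \<Longrightarrow> p u = B u + c" and "\<And>v. v \<in> V \<Longrightarrow> q v = B v + d"
proof -
  obtain u0 v0 where u0: "u0 \<in> U" and v0: "v0 \<in> V"
    using U V by blast
  obtain e1 where e1: "e1 > 0" "ball u0 e1 \<subseteq> U"
    using U(1) u0 open_contains_ball by blast
  obtain e2 where e2: "e2 > 0" "ball v0 e2 \<subseteq> V"
    using V(1) v0 open_contains_ball by blast
  define e where "e = min e1 e2"
  have e: "e > 0" using e1 e2 by (simp add: e_def)
  have inU: "u0 + t \<in> U" if "\<bar>t\<bar> < e" for t
    using that e1 by (auto simp: e_def dist_real_def subset_eq)
  have inV: "v0 + t \<in> V" if "\<bar>t\<bar> < e" for t
    using that e2 by (auto simp: e_def dist_real_def subset_eq)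
  define a where "a t = q (v0 + t) - q v0" for t
  have p_incr: "p (u + t) - p u = a t" if "u \<in> U" "u + t \<in> U" "\<bar>t\<bar> < e" for u t
    using eq[of "u + t" v0] eq[of u "v0 + t"] that v0 inV[of t]
    by (simp add: a_def algebra_simps)
  have q_incr: "q (v + t) - q v = a t" if "v \<in> V" "v + t \<in> V" "\<bar>t\<bar> < e" for v t
    using eq[of u0 "v + t"] eq[of "u0 + t" v] that u0 inU[of t] p_incr[of u0 t]
    by (simp add: algebra_simps)
  have "a (s + t) = a s + a t" if "\<bar>s\<bar> < e" "\<bar>t\<bar> < e" "\<bar>s + t\<bar> < e" for s t
    using p_incr[of u0 s] p_incr[of "u0 + s" t] p_incr[of u0 "s + t"] that u0
      inU[of s] inU[of "s + t"]
    by (simp add: add.assoc)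
  then obtain B where B: "Modules.additive B" and Ba: "\<And>t. \<bar>t\<bar> < e \<Longrightarrow> B t = a t"
    using locally_additive_extends[OF e, of a] by blast
  obtain c where "\<And>u. u \<in> U \<Longrightarrow> p u = B u + c"
    using additive_plus_constant_on_connected[OF U(2) B e, of p] p_incr Ba by metis
  moreover obtain d where "\<And>v. v \<in> V \<Longrightarrow> q v = B v + d"
    using additive_plus_constant_on_connected[OF V(2) B e, of q] q_incr Ba by metis
  ultimately show thesis
    using that B by blast
qed

lemma strictly_monotone_same_sense_on_imp_inj_on:
  assumes "strictly_monotone_same_sense_on I g h"
  shows "inj_on g I" and "inj_on h I"
  using assms unfolding strictly_monotone_same_sense_on_def
  by (auto simp: inj_on_def monotone_on_def) (metis less_irrefl linorder_neqE)+

theorem corollary8: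
  fixes I :: "real set" and F f\<^sub>1 f\<^sub>2 g\<^sub>1 g\<^sub>2 G :: "real \<Rightarrow> real"
  assumes "open I" and "is_interval I" and "I \<noteq> {}"
    and "midpoint_affine_on I F"
    and "continuous_on I g\<^sub>1" and "continuous_on I g\<^sub>2"
    and "strictly_monotone_same_sense_on I g\<^sub>1 g\<^sub>2"
  shows "(\<forall>x\<in>I. \<forall>y\<in>I. F ((x + y) / 2) + f\<^sub>1 x + f\<^sub>2 y = G (g\<^sub>1 x + g\<^sub>2 y)) \<longleftrightarrow>
    (\<exists>(B :: real \<Rightarrow> real) (\<mu>\<^sub>1 :: real) (\<mu>\<^sub>2 :: real) (\<Lambda> :: real). Modules.additive B \<and> \<Lambda> = \<mu>\<^sub>1 + \<mu>\<^sub>2 \<and>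
      (\<forall>x\<in>I. f\<^sub>1 x = - (1 / 2) * F x + B (g\<^sub>1 x) + \<mu>\<^sub>1) \<and>
      (\<forall>x\<in>I. f\<^sub>2 x = - (1 / 2) * F x + B (g\<^sub>2 x) + \<mu>\<^sub>2) \<and>
      (\<forall>z \<in> g\<^sub>1 ` I + g\<^sub>2 ` I. G z = B z + \<Lambda>))"
proof -
  let ?eq = "\<forall>x\<in>I. \<forall>y\<in>I. F ((x + y) / 2) + f\<^sub>1 x + f\<^sub>2 y = G (g\<^sub>1 x + g\<^sub>2 y)"
  have aff: "F ((x + y) / 2) = (F x + F y) / 2" if "x \<in> I" "y \<in> I" for x y
    using assms(4) that by (simp add: midpoint_affine_on_def)
  have inj: "inj_on g\<^sub>1 I" "inj_on g\<^sub>2 I"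
    using strictly_monotone_same_sense_on_imp_inj_on[OF assms(7)] by auto
  have conn: "connected I"
    using assms(2) by (simp add: is_interval_connected)
  have image_open: "open (g\<^sub>1 ` I)" "open (g\<^sub>2 ` I)"
    using invariance_of_domain assms(1,5,6) inj by blast+
  have image_conn: "connected (g\<^sub>1 ` I)" "connected (g\<^sub>2 ` I)"
    using connected_continuous_image conn assms(5,6) by blast+
  have image_ne: "g\<^sub>1 ` I \<noteq> {}" "g\<^sub>2 ` I \<noteq> {}"
    using assms(3) by simp_all
  show ?thesis
  proof (rule iffI)
    assume eq: ?eq
    define p where "p u = f\<^sub>1 (the_inv_into I g\<^sub>1 u) + F (the_inv_into I g\<^sub>1 u) / 2" for u
    define q where "q v = f\<^sub>2 (the_inv_into I g\<^sub>2 v) + F (the_inv_into I g\<^sub>2 v) / 2" for v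
    have p: "p (g\<^sub>1 x) = f\<^sub>1 x + F x / 2" and q: "q (g\<^sub>2 x) = f\<^sub>2 x + F x / 2" if "x \<in> I" for x
      using that inj by (simp_all add: p_def q_def the_inv_into_f_f)
    have pq: "p u + q v = G (u + v)" if "u \<in> g\<^sub>1 ` I" "v \<in> g\<^sub>2 ` I" for u v
    proof -
      obtain x y where xy: "x \<in> I" "y \<in> I" "u = g\<^sub>1 x" "v = g\<^sub>2 y"
        using \<open>u \<in> g\<^sub>1 ` I\<close> \<open>v \<in> g\<^sub>2 ` I\<close> by blast
      then show ?thesis
        using eq[rule_format, OF xy(1,2)] aff[OF xy(1,2)] p[OF xy(1)] q[OF xy(2)]
        by (simp add: add_divide_distrib)
    qed
    obtain B c d where B: "Modules.additive B"
      and pB: "\<And>u. u \<in> g\<^sub>1 ` I \<Longrightarrow> p u = B u + c"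
      and qB: "\<And>v. v \<in> g\<^sub>2 ` I \<Longrightarrow> q v = B v + d"
using pexider_on_open_intervals[OF image_open(1) image_conn(1) image_ne(1)
          image_open(2) image_conn(2) image_ne(2), of p q G] pq by blast
    have "f\<^sub>1 x = - (1 / 2) * F x + B (g\<^sub>1 x) + c" if "x \<in> I" for x
      using p[OF that] pB[of "g\<^sub>1 x"] that by simp
    moreover have "f\<^sub>2 x = - (1 / 2) * F x + B (g\<^sub>2 x) + d" if "x \<in> I" for x
      using q[OF that] qB[of "g\<^sub>2 x"] that by simp
    moreover have "G z = B z + (c + d)" if "z \<in> g\<^sub>1 ` I + g\<^sub>2 ` I" for z
      using that
    proof (rule set_plus_elim)
      fix u v assume "z = u + v" "u \<in> g\<^sub>1 ` I" "v \<in> g\<^sub>2 ` I"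
      then show ?thesis
        using pq[of u v] pB[of u] qB[of v] additive.add[OF B, of u v] by simp
    qed
    ultimately show "\<exists>B \<mu>\<^sub>1 \<mu>\<^sub>2 \<Lambda>. Modules.additive B \<and> \<Lambda> = \<mu>\<^sub>1 + \<mu>\<^sub>2 \<and>
      (\<forall>x\<in>I. f\<^sub>1 x = - (1 / 2) * F x + B (g\<^sub>1 x) + \<mu>\<^sub>1) \<and>
      (\<forall>x\<in>I. f\<^sub>2 x = - (1 / 2) * F x + B (g\<^sub>2 x) + \<mu>\<^sub>2) \<and>
      (\<forall>z \<in> g\<^sub>1 ` I + g\<^sub>2 ` I. G z = B z + \<Lambda>)"
      using B by blast
  next
    assume "\<exists>B \<mu>\<^sub>1 \<mu>\<^sub>2 \<Lambda>. Modules.additive B \<and> \<Lambda> = \<mu>\<^sub>1 + \<mu>\<^sub>2 \<and>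
      (\<forall>x\<in>I. f\<^sub>1 x = - (1 / 2) * F x + B (g\<^sub>1 x) + \<mu>\<^sub>1) \<and>
      (\<forall>x\<in>I. f\<^sub>2 x = - (1 / 2) * F x + B (g\<^sub>2 x) + \<mu>\<^sub>2) \<and>
      (\<forall>z \<in> g\<^sub>1 ` I + g\<^sub>2 ` I. G z = B z + \<Lambda>)"
    then obtain B c d where B: "Modules.additive B"
      and f1: "\<And>x. x \<in> I \<Longrightarrow> f\<^sub>1 x = - (1 / 2) * F x + B (g\<^sub>1 x) + c"
      and f2: "\<And>x. x \<in> I \<Longrightarrow> f\<^sub>2 x = - (1 / 2) * F x + B (g\<^sub>2 x) + d"
      and G: "\<And>z. z \<in> g\<^sub>1 ` I + g\<^sub>2 ` I \<Longrightarrow> G z = B z + (c + d)"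
      by blast
    show ?eq
    proof (intro ballI)
      fix x y assume xy: "x \<in> I" "y \<in> I"
      then have "G (g\<^sub>1 x + g\<^sub>2 y) = B (g\<^sub>1 x) + B (g\<^sub>2 y) + (c + d)"
        using G[of "g\<^sub>1 x + g\<^sub>2 y"] additive.add[OF B] by (simp add: set_plus_intro)
      then show "F ((x + y) / 2) + f\<^sub>1 x + f\<^sub>2 y = G (g\<^sub>1 x + g\<^sub>2 y)"
        using aff[OF xy] f1[OF xy(1)] f2[OF xy(2)] by (simp add: field_simps)
    qed
  qed
qed

end
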